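(* Let $G=G(n,p)$ be the Erdős–Rényi random graph on vertex set $\{1,\dots,n\}$ in which each possible edge is present independently with probability $p=p(n)\in(0,1)$. Let $t\ge2$ be a constant integer and $T$ a fixed (deterministic) labelled tree on $t$ vertices. If $p=o(1)$ and $np\to\infty$ as $n\to\infty$, then there are positive constants $D_1,D_2,D_3$ such that for all $n$ large, \[ \mathbb{P}\left(\frac{D_1np}{\log n}\le \chi_T(G)\le D_2(np)^{2\left(1-\frac1t\right)}\right)\ge 1-e^{-D_3(\log n)^2}-ne^{-D_3np}. \]
   Context: Logarithms are natural. A colouring of $G$ is any map $f:\{1,\dots,n\}\to\{1,\dots,k\}$ (not necessarily proper). A subgraph $H$ of $G$ with vertex set $V(H)$ is isomorphic to $T$ if there is a bijection $g:V(H)\to V(T)$ such that two vertices $u,v$ of $H$ are adjacent in $H$ if and only if $g(u),g(v)$ are adjacent in $T$. The colouring $f$ is a $T$-unique colouring of $G$ if every subgraph $H$ of $G$ isomorphic to $T$ contains at least one unique colour, i.e. a colour assigned by $f$ to exactly one vertex of $H$. $\chi_T(G)$ denotes the minimum number of colours needed for a $T$-unique colouring of $G$. *)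

theory Defs
  imports "HOL-Probability.Probability" "HOL-Library.Landau_Symbols"
begin

datatype 'a graph = Graph (verts: "'a set") (edges: "'a set set")

definition simple_graph :: "'a graph \<Rightarrow> bool" where
  "simple_graph G \<longleftrightarrow> (\<forall>e\<in>edges G. e \<subseteq> verts G \<and> card e = 2)"

definition adjacent :: "'a graph \<Rightarrow> 'a \<Rightarrow> 'a \<Rightarrow> bool" where
  "adjacent G u v \<longleftrightarrow> {u, v} \<in> edges G"

definition connected_graph :: "'a graph \<Rightarrow> bool" where
  "connected_graph G \<longleftrightarrow>
     verts G \<noteq> {} \<and> (\<forall>u\<in>verts G. \<forall>v\<in>verts G. (adjacent G)\<^sup>*\<^sup>* u v)"

text \<open>The list contains each vertex of the cycle once; the closing edge joins its last entry
  to its head.\<close>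

definition is_cycle :: "'a graph \<Rightarrow> 'a list \<Rightarrow> bool" where
  "is_cycle G vs \<longleftrightarrow> length vs \<ge> 3 \<and> distinct vs \<and>
     (\<forall>i. Suc i < length vs \<longrightarrow> adjacent G (vs ! i) (vs ! Suc i)) \<and>
     adjacent G (last vs) (hd vs)"

definition is_tree :: "'a graph \<Rightarrow> bool" where
  "is_tree G \<longleftrightarrow> simple_graph G \<and> connected_graph G \<and> (\<nexists>vs. is_cycle G vs)"

text \<open>Subgraphs are not required to be induced.\<close>

definition is_subgraph :: "'a graph \<Rightarrow> 'a graph \<Rightarrow> bool" where
  "is_subgraph H G \<longleftrightarrow> simple_graph H \<and> verts H \<subseteq> verts G \<and> edges H \<subseteq> edges G"

definition isomorphic :: "'a graph \<Rightarrow> 'b graph \<Rightarrow> bool" where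
  "isomorphic H T \<longleftrightarrow> (\<exists>g. bij_betw g (verts H) (verts T) \<and>
     (\<forall>u\<in>verts H. \<forall>v\<in>verts H. adjacent H u v \<longleftrightarrow> adjacent T (g u) (g v)))"

definition unique_colouring :: "'b graph \<Rightarrow> 'a graph \<Rightarrow> nat \<Rightarrow> ('a \<Rightarrow> nat) \<Rightarrow> bool" where
  "unique_colouring T G k f \<longleftrightarrow> f \<in> verts G \<rightarrow> {1..k} \<and>
     (\<forall>H. is_subgraph H G \<and> isomorphic H T \<longrightarrow> (\<exists>c. \<exists>!v. v \<in> verts H \<and> f v = c))"

definition unique_chromatic_number :: "'b graph \<Rightarrow> 'a graph \<Rightarrow> nat" where
  "unique_chromatic_number T G = (LEAST k. \<exists>f. unique_colouring T G k f)"

text \<open>The minimum is attained: an injective colouring of a finite graph is \<open>T\<close>-unique.\<close>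

lemma ex_unique_colouring:
  assumes "finite (verts G)" and "verts T \<noteq> {}"
  shows "\<exists>k f. unique_colouring T G k f"
proof -
  obtain f where f: "bij_betw f (verts G) {1..card (verts G)}"
    using finite_same_card_bij[OF assms(1), of "{1..card (verts G)}"] by auto
  have "\<exists>c. \<exists>!v. v \<in> verts H \<and> f v = c" if h: "is_subgraph H G" "isomorphic H T" for H
  proof -
    have sub: "verts H \<subseteq> verts G"
      using h(1) by (simp add: is_subgraph_def)
    obtain v where v: "v \<in> verts H"
      using h(2) assms(2) unfolding isomorphic_def bij_betw_def by blast
    have "\<exists>!u. u \<in> verts H \<and> f u = f v"
      using v sub f unfolding bij_betw_def inj_on_def by blast
    then show ?thesis by blast
  qed
  moreover have "f \<in> verts G \<rightarrow> {1..card (verts G)}"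
    using f by (auto simp: bij_betw_def)
  ultimately show ?thesis
    unfolding unique_colouring_def by blast
qed

definition possible_edges :: "nat \<Rightarrow> nat set set" where
  "possible_edges n = {e. e \<subseteq> {1..n} \<and> card e = 2}"

definition erdos_renyi :: "nat \<Rightarrow> real \<Rightarrow> nat graph pmf" where
  "erdos_renyi n p =
     map_pmf (\<lambda>b. Graph {1..n} {e \<in> possible_edges n. b e})
       (Pi_pmf (possible_edges n) False (\<lambda>_. bernoulli_pmf p))"

end

theory Submission
  imports Defs
begin

text \<open>
  Upper bound. With the required probability all degrees are at most \<open>9np\<close>, so each vertex lies
  in \<open>O((np)^(t-1))\<close> copies of \<open>T\<close>. A copy without a unique colour uses each of its colours at
  least twice, hence is determined by at most half of its colours and a bounded amount of
  combinatorial data. Rosenfeld's counting method (an elementary substitute for the Local Lemma)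
  then shows that, with \<open>k\<close> of order \<open>(np)^(2(t-1)/t)\<close> colours, each further vertex multiplies
  the number of good partial colourings by at least \<open>k/2\<close>.

  Lower bound. With \<open>s\<close> of order \<open>log n / p\<close>, the union bound shows that any two disjoint
  \<open>s\<close>-sets are joined by an edge. Then every set of \<open>t^2 s\<close> vertices contains a copy of \<open>T\<close>,
  embedded leaf by leaf, so no colour class can be that large.
\<close>

section \<open>Counting colourings with unique colours\<close>

definition has_unique_colour :: "('a \<Rightarrow> 'c) \<Rightarrow> 'a set \<Rightarrow> bool" where
  "has_unique_colour f e \<longleftrightarrow> (\<exists>c. \<exists>!v. v \<in> e \<and> f v = c)"

lemma has_unique_colour_cong:
  assumes "\<And>x. x \<in> e \<Longrightarrow> f x = g x"
  shows "has_unique_colour f e \<longleftrightarrow> has_unique_colour g e"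
  using assms unfolding has_unique_colour_def by (metis (no_types, lifting))

text \<open>A colouring without a unique colour on \<open>e\<close> is invariant under a map sending each point to a
  representative of its colour class; such a map can be taken to move \<open>v\<close> and at least half of
  \<open>e\<close>.\<close>

definition collapse_maps :: "'a set \<Rightarrow> 'a \<Rightarrow> ('a \<Rightarrow> 'a) set" where
  "collapse_maps e v = {g \<in> e \<rightarrow>\<^sub>E e. (\<forall>x\<in>e. g (g x) = g x) \<and> g v \<noteq> v \<and>
     card e \<le> 2 * card {x\<in>e. g x \<noteq> x}}"

text \<open>No colour class on \<open>e\<close> is a singleton, so every class, including that of
  \<open>v\<close>, has a representative other than \<open>v\<close>. The fixed points are the
  representatives, and each shares its class with a moved point; hence at least half of
  \<open>e\<close> moves.\<close>

lemma ex_collapse_map: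
  assumes fin: "finite e" and v: "v \<in> e" and no: "\<not> has_unique_colour f e"
  shows "\<exists>g\<in>collapse_maps e v. \<forall>x\<in>e. f (g x) = f x"
proof -
  have other: "\<exists>y\<in>e. y \<noteq> x \<and> f y = f x" if "x \<in> e" for x
    using no that unfolding has_unique_colour_def by metis
  \<comment> \<open>The representative depends on the colour only, which makes \<open>g\<close>
    constant on colour classes and idempotent.\<close>
  define r where "r = (\<lambda>c. SOME y. y \<in> e \<and> y \<noteq> v \<and> f y = c)"
  have r: "r (f x) \<in> e \<and> r (f x) \<noteq> v \<and> f (r (f x)) = f x" if "x \<in> e" for x
  proof -
    have "\<exists>y. y \<in> e \<and> y \<noteq> v \<and> f y = f x"
      using other[OF that] other[OF v] that by metis
    then show ?thesis unfolding r_def by (rule someI_ex)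
  qed
  define g where "g = (\<lambda>x\<in>e. r (f x))"
  define F where "F = {x\<in>e. g x = x}"
  define X where "X = {x\<in>e. g x \<noteq> x}"
  have finF: "finite F" and finX: "finite X" using fin by (auto simp: F_def X_def)
  \<comment> \<open>Sending each representative to another vertex of its colour injects the fixed points into
    the moved points.\<close>
  define q where "q = (\<lambda>x. SOME y. y \<in> e \<and> y \<noteq> x \<and> f y = f x)"
  have q: "q x \<in> e \<and> q x \<noteq> x \<and> f (q x) = f x" if "x \<in> e" for x
  proof -
    have "\<exists>y. y \<in> e \<and> y \<noteq> x \<and> f y = f x" using other[OF that] by blast
    then show ?thesis unfolding q_def by (rule someI_ex)
  qed
  have "inj_on q F"
  proof (rule inj_onI)
    fix x y assume xy: "x \<in> F" "y \<in> F" "q x = q y"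
    then have "f x = f y" using q[of x] q[of y] by (auto simp: F_def)
    then show "x = y" using xy by (auto simp: F_def g_def)
  qed
  moreover have "q ` F \<subseteq> X"
  proof
    fix z assume "z \<in> q ` F"
    then obtain x where x: "x \<in> F" "z = q x" by blast
    then have "x \<in> e" "g x = x" by (auto simp: F_def)
    then show "z \<in> X" using q[of x] x(2) by (auto simp: X_def g_def)
  qed
  ultimately have "card F \<le> card X" using finX by (rule card_inj_on_le)
  moreover have "card e = card F + card X"
  proof -
    have "e = F \<union> X" "F \<inter> X = {}" by (auto simp: F_def X_def)
    then show ?thesis using finF finX by (metis card_Un_disjoint)
  qed
  ultimately have "card e \<le> 2 * card {x\<in>e. g x \<noteq> x}" by (simp add: X_def)
  then have "g \<in> collapse_maps e v"
    using r v by (auto simp: collapse_maps_def g_def)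
  moreover have "\<forall>x\<in>e. f (g x) = f x" using r by (simp add: g_def)
  ultimately show ?thesis by blast
qed

lemma finite_collapse_maps: "finite e \<Longrightarrow> finite (collapse_maps e v)"
  unfolding collapse_maps_def by (rule finite_subset[OF _ finite_PiE[of e "\<lambda>_. e"]]) auto

lemma card_collapse_maps_le: 
  assumes "finite e"
  shows "card (collapse_maps e v) \<le> card e ^ card e"
proof -
  have "card (collapse_maps e v) \<le> card (e \<rightarrow>\<^sub>E e)"
    unfolding collapse_maps_def using assms by (intro card_mono finite_PiE) auto
  also have "\<dots> = card e ^ card e" using assms by (simp add: card_PiE)
  finally show ?thesis .
qed

section \<open>Partial colourings and their extensions by one vertex\<close>

definition partial_colourings :: "'a set set \<Rightarrow> nat \<Rightarrow> 'a set \<Rightarrow> ('a \<Rightarrow> nat) set" where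
  "partial_colourings E k S =
     {f \<in> S \<rightarrow>\<^sub>E {1..k}. \<forall>e\<in>E. e \<subseteq> S \<longrightarrow> has_unique_colour f e}"

lemma finite_partial_colourings: "finite S \<Longrightarrow> finite (partial_colourings E k S)"
  unfolding partial_colourings_def
  by (rule finite_subset[OF _ finite_PiE[of S "\<lambda>_. {1..k}"]]) auto

lemma restrict_partial_colourings:
  assumes "f \<in> partial_colourings E k S" "A \<subseteq> S"
  shows "restrict f A \<in> partial_colourings E k A"
proof -
  have "has_unique_colour (restrict f A) e" if "e \<in> E" "e \<subseteq> A" for e
  proof -
    have "has_unique_colour f e" using assms that by (auto simp: partial_colourings_def)
    moreover have "has_unique_colour (restrict f A) e \<longleftrightarrow> has_unique_colour f e"
      using that by (intro has_unique_colour_cong) auto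
    ultimately show ?thesis by simp
  qed
  then show ?thesis using assms by (auto simp: partial_colourings_def)
qed

text \<open>A spoiled extension is recovered from its restriction to the points not moved by the
  collapse map.\<close>

lemma card_collapsed_colourings_le:
  assumes fin: "finite S" and v: "v \<notin> S" and e: "e \<subseteq> insert v S" "v \<in> e"
    and g: "g \<in> collapse_maps e v"
  defines "X \<equiv> {x\<in>e. g x \<noteq> x}"
  shows "card {f \<in> insert v S \<rightarrow>\<^sub>E {1..k}. restrict f S \<in> partial_colourings E k S \<and>
           (\<forall>x\<in>e. f (g x) = f x)} \<le> card (partial_colourings E k (S - X))"
    (is "card ?B \<le> _")
proof (rule card_inj_on_le)
  have vX: "v \<in> X" using g e by (auto simp: X_def collapse_maps_def)
  \<comment> \<open>Idempotence puts \<open>g x\<close> outside \<open>X\<close>, and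
    \<open>v\<close> lies in \<open>X\<close>, so the colour of every moved point can be read off at
    a point of \<open>S - X\<close>.\<close>
  have gX: "g x \<in> S - X" if "x \<in> X" for x
  proof -
    have "g x \<in> e" "g (g x) = g x" using g that by (auto simp: X_def collapse_maps_def)
    then show ?thesis using e vX by (auto simp: X_def)
  qed
  show "inj_on (\<lambda>f. restrict f (S - X)) ?B"
  proof (rule inj_onI)
    fix f f' assume f: "f \<in> ?B" and f': "f' \<in> ?B"
      and eq: "restrict f (S - X) = restrict f' (S - X)"
    have off: "f x = f' x" if "x \<in> S - X" for x
      using fun_cong[OF eq, of x] that by simp
    have on: "f x = f' x" if "x \<in> X" for x
    proof -
      have "f (g x) = f x" "f' (g x) = f' x" using f f' that by (auto simp: X_def)
      then show ?thesis using off[OF gX[OF that]] by simp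
    qed
    show "f = f'"
    proof (rule PiE_ext)
      show "f \<in> insert v S \<rightarrow>\<^sub>E {1..k}" "f' \<in> insert v S \<rightarrow>\<^sub>E {1..k}" using f f' by blast+
      show "f x = f' x" if "x \<in> insert v S" for x
        using that off on vX by (cases "x \<in> X") auto
    qed
  qed
  show "(\<lambda>f. restrict f (S - X)) ` ?B \<subseteq> partial_colourings E k (S - X)"
  proof clarsimp
    fix f assume "restrict f S \<in> partial_colourings E k S"
    from restrict_partial_colourings[OF this, of "S - X"]
    show "restrict f (S - X) \<in> partial_colourings E k (S - X)"
      by (simp add: Int_absorb1)
  qed
  show "finite (partial_colourings E k (S - X))"
    using fin by (simp add: finite_partial_colourings)
qed

text \<open>An edge avoiding \<open>v\<close> keeps the unique colour it has under the restriction.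
  A failed extension therefore fails on an edge through \<open>v\<close>, where
  \<open>ex_collapse_map\<close> applies.\<close>

lemma extensions_covered:
  assumes fin: "finite S" and v: "v \<notin> S"
    and f: "f \<in> insert v S \<rightarrow>\<^sub>E {1..k}" "restrict f S \<in> partial_colourings E k S"
  shows "f \<in> partial_colourings E k (insert v S) \<or>
    (\<exists>e\<in>{e\<in>E. v \<in> e \<and> e \<subseteq> insert v S}. \<exists>g\<in>collapse_maps e v. \<forall>x\<in>e. f (g x) = f x)"
proof (rule disjCI)
  assume "\<not> (\<exists>e\<in>{e\<in>E. v \<in> e \<and> e \<subseteq> insert v S}. \<exists>g\<in>collapse_maps e v. \<forall>x\<in>e. f (g x) = f x)"
  then have new: "has_unique_colour f e" if "e \<in> E" "v \<in> e" "e \<subseteq> insert v S" for e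
    using ex_collapse_map[of e v f] that finite_subset[of e "insert v S"] fin by blast
  have old: "has_unique_colour f e" if "e \<in> E" "e \<subseteq> S" for e
  proof -
    have "has_unique_colour (restrict f S) e" using f that by (auto simp: partial_colourings_def)
    moreover have "has_unique_colour (restrict f S) e \<longleftrightarrow> has_unique_colour f e"
      using that by (intro has_unique_colour_cong) auto
    ultimately show ?thesis by simp
  qed
  have "has_unique_colour f e" if "e \<in> E" "e \<subseteq> insert v S" for e
    using old[of e] new[of e] that by (cases "v \<in> e") auto
  then show "f \<in> partial_colourings E k (insert v S)"
    using f by (simp add: partial_colourings_def)
qed

text \<open>The induction step of Rosenfeld's method. Spoiled extensions are charged to an edge
  through \<open>v\<close> and a collapse map, at most \<open>N * t ^ t\<close> pairs. Each pair
  moves at least \<open>h = (t + 1) div 2\<close> points, so by \<open>IH\<close> it accounts for at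
  most \<open>C S / \<beta> ^ (h - 1)\<close> extensions. In total at most
  \<open>\<beta> * C S\<close> of the \<open>k * C S\<close> extensions are lost, and
  \<open>k\<close> is at least \<open>2 * \<beta>\<close>.\<close>

lemma card_partial_colourings_insert_ge:
  fixes \<beta> :: real
  assumes fin: "finite S" and v: "v \<notin> S"
    and E: "\<And>e. e \<in> E \<Longrightarrow> card e = t" and t: "t \<ge> 1"
    and N: "finite {e\<in>E. v \<in> e}" "card {e\<in>E. v \<in> e} \<le> N"
    and \<beta>: "\<beta> \<ge> 1" "2 * \<beta> \<le> real k" "real (N * t ^ t) \<le> \<beta> ^ ((t + 1) div 2)"
    and IH: "\<And>A. A \<subseteq> S \<Longrightarrow> \<beta> ^ card (S - A) * real (card (partial_colourings E k A))
               \<le> real (card (partial_colourings E k S))"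
  shows "\<beta> * real (card (partial_colourings E k S))
           \<le> real (card (partial_colourings E k (insert v S)))"
proof -
  define C where "C = (\<lambda>S. real (card (partial_colourings E k S)))"
  define h where "h = (t + 1) div 2"
  have h1: "h \<ge> 1" using t by (simp add: h_def)
  define Ev where "Ev = {e\<in>E. v \<in> e \<and> e \<subseteq> insert v S}"
  have Ev: "finite Ev" "card Ev \<le> N"
  proof -
    have sub: "Ev \<subseteq> {e\<in>E. v \<in> e}" by (auto simp: Ev_def)
    show "finite Ev" using finite_subset[OF sub N(1)] .
    show "card Ev \<le> N" using card_mono[OF N(1) sub] N(2) by simp
  qed
  define All where "All = {f \<in> insert v S \<rightarrow>\<^sub>E {1..k}. restrict f S \<in> partial_colourings E k S}"
  define B where "B = (\<lambda>e g. {f \<in> insert v S \<rightarrow>\<^sub>E {1..k}.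
      restrict f S \<in> partial_colourings E k S \<and> (\<forall>x\<in>e. f (g x) = f x)})"
  have finB: "finite (B e g)" for e g
    unfolding B_def using fin
    by (intro finite_subset[OF _ finite_PiE[of "insert v S" "\<lambda>_. {1..k}"]]) auto
  have finAll: "finite All"
    unfolding All_def using fin
    by (intro finite_subset[OF _ finite_PiE[of "insert v S" "\<lambda>_. {1..k}"]]) auto
  have "card (partial_colourings E k S \<times> {1..k}) \<le> card All"
  proof (rule card_inj_on_le)
    show "inj_on (\<lambda>(f, c). f(v := c)) (partial_colourings E k S \<times> {1..k})"
    proof (rule inj_onI, clarify)
      fix f c f' c'
      assume f: "f \<in> partial_colourings E k S" "f' \<in> partial_colourings E k S"
        and eq: "f(v := c) = f'(v := c')"
      have "c = c'" using fun_cong[OF eq, of v] by simp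
      moreover have "f = f'"
      proof
        fix x
        \<comment> \<open>Both functions are extensional, so overwriting their value at
          \<open>v\<close> loses no information.\<close>
        have "f v = undefined" "f' v = undefined"
          using f v by (auto simp: partial_colourings_def PiE_def extensional_def)
        then show "f x = f' x" using fun_cong[OF eq, of x] by (cases "x = v") auto
      qed
      ultimately show "f = f' \<and> c = c'" by simp
    qed
    show "(\<lambda>(f, c). f(v := c)) ` (partial_colourings E k S \<times> {1..k}) \<subseteq> All"
    proof clarify
      fix f c assume f: "f \<in> partial_colourings E k S" and c: "c \<in> {1..k}"
      have fP: "f \<in> S \<rightarrow>\<^sub>E {1..k}" using f by (simp add: partial_colourings_def)
      have "restrict (f(v := c)) S = f"
        using fP v by (auto simp: PiE_def extensional_def restrict_def)
      moreover have "f(v := c) \<in> insert v S \<rightarrow>\<^sub>E {1..k}"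
        using fP c by (rule PiE_fun_upd[rotated])
      ultimately show "f(v := c) \<in> All" using f by (simp add: All_def)
    qed
  qed (rule finAll)
  then have all: "real k * C S \<le> real (card All)"
    by (simp add: C_def card_cartesian_product mult.commute flip: of_nat_mult)
  have cover: "All \<subseteq> partial_colourings E k (insert v S) \<union>
      (\<Union>e\<in>Ev. \<Union>g\<in>collapse_maps e v. B e g)"
  proof
    fix f assume f: "f \<in> All"
    then have f': "f \<in> insert v S \<rightarrow>\<^sub>E {1..k}" "restrict f S \<in> partial_colourings E k S"
      by (auto simp: All_def)
    show "f \<in> partial_colourings E k (insert v S) \<union> (\<Union>e\<in>Ev. \<Union>g\<in>collapse_maps e v. B e g)"
      using extensions_covered[OF fin v f'] f' unfolding Ev_def[symmetric] B_def by auto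
  qed
  have Bb: "real (card (B e g)) \<le> C S / \<beta> ^ (h - 1)"
    if e: "e \<in> Ev" and g: "g \<in> collapse_maps e v" for e g
  proof -
    define X where "X = {x\<in>e. g x \<noteq> x}"
    have eS: "e \<subseteq> insert v S" "v \<in> e" "card e = t" using e E by (auto simp: Ev_def)
    have "finite e" using eS(1) fin finite_subset by blast
    then have finX: "finite X" by (simp add: X_def)
    have vX: "v \<in> X" and cX: "t \<le> 2 * card X"
      using g eS by (auto simp: X_def collapse_maps_def)
    \<comment> \<open>The moved point \<open>v\<close> lies outside \<open>S\<close>, so only
      \<open>card X - 1\<close> points of \<open>S\<close> are given up.\<close>
    have "S - (S - X) = X - {v}" using eS v by (auto simp: X_def)
    then have cc: "card (S - (S - X)) = card X - 1" using finX vX by simp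
    have "h - 1 \<le> card X - 1" using cX by (simp add: h_def)
    then have pw: "\<beta> ^ (h - 1) \<le> \<beta> ^ (card X - 1)" using \<beta>(1) by (rule power_increasing)
    have "card (B e g) \<le> card (partial_colourings E k (S - X))"
      unfolding B_def X_def by (rule card_collapsed_colourings_le[OF fin v eS(1,2) g])
    then have "\<beta> ^ (h - 1) * real (card (B e g)) \<le> \<beta> ^ (card X - 1) * C (S - X)"
      unfolding C_def using pw \<beta>(1) by (intro mult_mono) auto
    also have "\<dots> \<le> C S" using IH[of "S - X"] cc by (simp add: C_def)
    finally show ?thesis using \<beta>(1) by (simp add: field_simps)
  qed
  have "real (card (\<Union>e\<in>Ev. \<Union>g\<in>collapse_maps e v. B e g)) \<le>
      (\<Sum>e\<in>Ev. \<Sum>g\<in>collapse_maps e v. real (card (B e g)))"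
  proof -
    have "card (\<Union>e\<in>Ev. \<Union>g\<in>collapse_maps e v. B e g)
        \<le> (\<Sum>e\<in>Ev. card (\<Union>g\<in>collapse_maps e v. B e g))" using Ev(1) by (rule card_UN_le)
    also have "\<dots> \<le> (\<Sum>e\<in>Ev. \<Sum>g\<in>collapse_maps e v. card (B e g))"
    proof (intro sum_mono card_UN_le finite_collapse_maps)
      fix e assume "e \<in> Ev"
      then have "e \<subseteq> insert v S" by (simp add: Ev_def)
      then show "finite e" using fin finite_subset by blast
    qed
    finally show ?thesis by (simp flip: of_nat_sum)
  qed
  also have "\<dots> \<le> (\<Sum>e\<in>Ev. \<Sum>g\<in>collapse_maps e v. C S / \<beta> ^ (h - 1))"
    by (intro sum_mono Bb)
  also have "\<dots> \<le> (\<Sum>e\<in>Ev. real (t ^ t) * (C S / \<beta> ^ (h - 1)))"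
  proof (rule sum_mono)
    fix e assume e: "e \<in> Ev"
    then have "e \<subseteq> insert v S" "card e = t" using E by (auto simp: Ev_def)
    then have "card (collapse_maps e v) \<le> t ^ t"
      using card_collapse_maps_le[of e v] fin finite_subset by blast
    then have "real (card (collapse_maps e v)) * (C S / \<beta> ^ (h - 1))
        \<le> real (t ^ t) * (C S / \<beta> ^ (h - 1))"
      using \<beta>(1) by (intro mult_right_mono) (auto simp: C_def simp del: of_nat_power)
    then show "(\<Sum>g\<in>collapse_maps e v. C S / \<beta> ^ (h - 1)) \<le> real (t ^ t) * (C S / \<beta> ^ (h - 1))"
      by simp
  qed
  also have "\<dots> \<le> real N * (real (t ^ t) * (C S / \<beta> ^ (h - 1)))"
    unfolding sum_constant using Ev(2) \<beta>(1) by (intro mult_right_mono) (auto simp: C_def)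
  also have "\<dots> = real (N * t ^ t) * (C S / \<beta> ^ (h - 1))" by simp
  also have "\<dots> \<le> \<beta> ^ h * (C S / \<beta> ^ (h - 1))"
    using \<beta> by (intro mult_right_mono) (auto simp: C_def h_def)
  also have "\<dots> = \<beta> * C S"
    using \<beta>(1) h1 by (cases h) auto
  finally have bad: "real (card (\<Union>e\<in>Ev. \<Union>g\<in>collapse_maps e v. B e g)) \<le> \<beta> * C S" .
  have "real k * C S \<le> real (card All)" by (rule all)
  also have "\<dots> \<le> real (card (partial_colourings E k (insert v S) \<union>
      (\<Union>e\<in>Ev. \<Union>g\<in>collapse_maps e v. B e g)))"
  proof -
    have "finite (\<Union>g\<in>collapse_maps e v. B e g)" if "e \<in> Ev" for e
    proof -
      have "e \<subseteq> insert v S" using that by (simp add: Ev_def)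
      then have "finite e" using fin finite_subset by blast
      then show ?thesis using finB by (intro finite_UN_I finite_collapse_maps)
    qed
    then have "finite (partial_colourings E k (insert v S) \<union>
      (\<Union>e\<in>Ev. \<Union>g\<in>collapse_maps e v. B e g))"
      using Ev(1) fin by (simp add: finite_partial_colourings)
    then show ?thesis using cover by (simp add: card_mono)
  qed
  also have "\<dots> \<le> C (insert v S) + real (card (\<Union>e\<in>Ev. \<Union>g\<in>collapse_maps e v. B e g))"
    unfolding C_def of_nat_add[symmetric] of_nat_le_iff by (rule card_Un_le)
  also have "\<dots> \<le> C (insert v S) + \<beta> * C S" using bad by simp
  finally have "(real k - \<beta>) * C S \<le> C (insert v S)" by (simp add: algebra_simps)
  moreover have "\<beta> * C S \<le> (real k - \<beta>) * C S"
    using \<beta>(2) by (intro mult_right_mono) (auto simp: C_def)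
  ultimately show ?thesis by (simp add: C_def)
qed

text \<open>Starting from the one colouring of the empty set, each inserted point multiplies the
  count by at least \<open>\<beta>\<close>, so the final count is positive.\<close>

lemma ex_colouring_with_unique_colours:
  fixes \<beta> :: real
  assumes fin: "finite V"
    and E: "\<And>e. e \<in> E \<Longrightarrow> e \<subseteq> V" "\<And>e. e \<in> E \<Longrightarrow> card e = t" and t: "t \<ge> 1"
    and N: "\<And>v. v \<in> V \<Longrightarrow> card {e\<in>E. v \<in> e} \<le> N"
    and \<beta>: "\<beta> \<ge> 1" "2 * \<beta> \<le> real k" "real (N * t ^ t) \<le> \<beta> ^ ((t + 1) div 2)"
  shows "\<exists>f \<in> V \<rightarrow> {1..k}. \<forall>e\<in>E. has_unique_colour f e"
proof -
  have finE: "finite E" using E(1) fin by (meson PowI finite_Pow_iff finite_subset subsetI)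
  \<comment> \<open>A collapse map removes several points at once, so the induction compares
    \<open>S\<close> with all its subsets and not only with \<open>S\<close> minus a point.\<close>
  have ge: "S \<subseteq> V \<Longrightarrow> A \<subseteq> S \<Longrightarrow> \<beta> ^ card (S - A) * real (card (partial_colourings E k A))
               \<le> real (card (partial_colourings E k S))" if "finite S" for S A
    using that
  proof (induction S arbitrary: A rule: finite_psubset_induct)
    case (psubset S)
    show ?case
    proof (cases "A = S")
      case False
      then obtain v where v: "v \<in> S" "v \<notin> A" using psubset.prems by blast
      define S' where "S' = S - {v}"
      have S': "S' \<subset> S" "finite S'" "v \<notin> S'" "S = insert v S'" "A \<subseteq> S'" "S' \<subseteq> V"
        using v psubset by (auto simp: S'_def)
      have step: "\<beta> * real (card (partial_colourings E k S'))
           \<le> real (card (partial_colourings E k (insert v S')))"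
      proof (rule card_partial_colourings_insert_ge[OF S'(2,3) E(2) t _ _ \<beta>])
        show "finite {e\<in>E. v \<in> e}" using finE by simp
        show "card {e\<in>E. v \<in> e} \<le> N" using N v psubset.prems by blast
        show "\<beta> ^ card (S' - A) * real (card (partial_colourings E k A))
               \<le> real (card (partial_colourings E k S'))" if "A \<subseteq> S'" for A
          using psubset.IH[OF S'(1) S'(6) that] .
      qed
      have "card (S - A) = Suc (card (S' - A))"
        using S' v by (simp add: insert_Diff_if)
      then have "\<beta> ^ card (S - A) * real (card (partial_colourings E k A))
          = \<beta> * (\<beta> ^ card (S' - A) * real (card (partial_colourings E k A)))" by simp
      also have "\<dots> \<le> \<beta> * real (card (partial_colourings E k S'))"
        using psubset.IH[OF S'(1) S'(6) S'(5)] \<beta>(1) by (intro mult_left_mono) auto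
      also have "\<dots> \<le> real (card (partial_colourings E k S))" using step S'(4) by simp
      finally show ?thesis .
    qed simp
  qed
  \<comment> \<open>Edges have \<open>t \<ge> 1\<close> points, so none is contained in the empty
    set.\<close>
  have "partial_colourings E k {} = {\<lambda>_. undefined}"
    using E(2) t by (fastforce simp: partial_colourings_def)
  then have "\<beta> ^ card V \<le> real (card (partial_colourings E k V))"
    using ge[OF fin, of "{}"] by simp
  moreover have "\<beta> ^ card V > 0" using \<beta>(1) by simp
  ultimately have "card (partial_colourings E k V) > 0" by linarith
  then obtain f where "f \<in> partial_colourings E k V" by (metis card_gt_0_iff ex_in_conv)
  then show ?thesis using E(1) by (auto simp: partial_colourings_def PiE_def)
qed

section \<open>Trees grown by adding leaves\<close>

text \<open>The uniqueness premise of \<open>leaf\<close> encodes acyclicity in the form that later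
  inductions use: extending a map to \<open>x\<close> has to respect a single edge.\<close>

inductive grown :: "'a graph \<Rightarrow> 'a \<Rightarrow> 'a set \<Rightarrow> bool" for T u where
  root: "u \<in> verts T \<Longrightarrow> grown T u {u}"
| leaf: "\<lbrakk>grown T u A; y \<in> A; x \<in> verts T; x \<notin> A; adjacent T y x;
          \<forall>z\<in>A. adjacent T z x \<longrightarrow> z = y\<rbrakk> \<Longrightarrow> grown T u (insert x A)"

lemma adjacent_commute: "adjacent G x y \<longleftrightarrow> adjacent G y x"
  by (simp add: adjacent_def insert_commute)

lemma not_adjacent_self: "simple_graph G \<Longrightarrow> \<not> adjacent G x x"
  by (auto simp: adjacent_def simple_graph_def)

lemma adjacent_verts: "simple_graph G \<Longrightarrow> adjacent G x y \<Longrightarrow> x \<in> verts G \<and> y \<in> verts G"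
  by (auto simp: adjacent_def simple_graph_def)

lemma grown_subset: "grown T u A \<Longrightarrow> A \<subseteq> verts T"
  by (induction rule: grown.induct) auto

lemma grown_root: "grown T u A \<Longrightarrow> u \<in> A"
  by (induction rule: grown.induct) auto

lemma grown_finite: "grown T u A \<Longrightarrow> finite A"
  by (induction rule: grown.induct) auto

definition path_in :: "'a graph \<Rightarrow> 'a set \<Rightarrow> 'a \<Rightarrow> 'a \<Rightarrow> 'a list \<Rightarrow> bool" where
  "path_in T A y z vs \<longleftrightarrow> vs \<noteq> [] \<and> distinct vs \<and> set vs \<subseteq> A \<and> hd vs = y \<and> last vs = z \<and>
     successively (adjacent T) vs"

text \<open>The paths serve \<open>tree_grown\<close>, where one is closed up to a cycle. An added
  leaf needs only one extra edge at an end of an old path.\<close>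

lemma grown_paths:
  assumes "grown T u A" "y \<in> A" "z \<in> A"
  shows "\<exists>vs. path_in T A y z vs"
  using assms
proof (induction arbitrary: y z rule: grown.induct)
  case root
  then have "path_in T {u} y z [u]" by (auto simp: path_in_def)
  then show ?case by blast
next
  case (leaf A w x)
  have ext: "path_in T (insert x A) y z vs" if "path_in T A y z vs" for y z vs
    using that by (auto simp: path_in_def)
  have app: "path_in T (insert x A) y x (vs @ [x])" if "path_in T A y w vs" for y vs
    using that leaf.hyps(2-5) by (auto simp: path_in_def successively_append_iff)
  have pre: "path_in T (insert x A) x z (x # vs)" if "path_in T A w z vs" for z vs
    using that leaf.hyps(2-5) adjacent_commute[of T x w]
    by (auto simp: path_in_def successively_Cons)
  have "path_in T (insert x A) x x [x]" by (auto simp: path_in_def)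
  moreover have "\<exists>vs. path_in T A a b vs" if "a \<in> A" "b \<in> A" for a b
    using leaf.IH that by blast
  ultimately show ?case
    using leaf.prems leaf.hyps(2) ext app pre by (cases "y = x"; cases "z = x") (simp; metis)+
qed

text \<open>A maximal grown set is everything. Otherwise connectivity gives an edge leaving it; a
  second neighbour of the outer endpoint would close a path inside the set to a cycle, so the
  endpoint could be added.\<close>

lemma tree_grown:
  assumes tree: "is_tree T" and fin: "finite (verts T)" and u: "u \<in> verts T"
  shows "grown T u (verts T)"
proof -
  have "finite {A. grown T u A}"
    using fin grown_subset by (metis PowI finite_Pow_iff finite_subset mem_Collect_eq subsetI)
  moreover have "{A. grown T u A} \<noteq> {}" using root[OF u] by blast
  ultimately obtain A where A: "grown T u A" and max: "\<And>B. grown T u B \<Longrightarrow> A \<subseteq> B \<Longrightarrow> B = A"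
    using finite_has_maximal[of "{A. grown T u A}"] by auto
  have simple: "simple_graph T" using tree by (simp add: is_tree_def)
  have "A = verts T"
  proof (rule ccontr)
    assume "A \<noteq> verts T"
    then obtain w where w: "w \<in> verts T" "w \<notin> A" using grown_subset[OF A] by blast
    have "(adjacent T)\<^sup>*\<^sup>* u w" using tree u w by (simp add: is_tree_def connected_graph_def)
    then have "w \<notin> A \<longrightarrow> (\<exists>y x. y \<in> A \<and> x \<notin> A \<and> adjacent T y x)"
      by (induction rule: rtranclp_induct) (use grown_root[OF A] in blast)+
    then obtain y x where yx: "y \<in> A" "x \<notin> A" "adjacent T y x" using w by blast
    have "z = y" if z: "z \<in> A" "adjacent T z x" for z
    proof (rule ccontr)
      assume ne: "z \<noteq> y"
      obtain vs where vs: "path_in T A y z vs" using grown_paths[OF A yx(1) z(1)] by blast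
      \<comment> \<open>The ends differ, so the path has at least two vertices; adding
        \<open>x\<close> gives the three that \<open>is_cycle\<close> demands.\<close>
      have len: "length vs \<ge> 2"
        using vs ne by (cases vs; cases "tl vs") (auto simp: path_in_def)
      have sx: "successively (adjacent T) (vs @ [x])"
        using vs z by (auto simp: path_in_def successively_append_iff)
      have "is_cycle T (vs @ [x])"
        unfolding is_cycle_def
      proof (intro conjI allI impI)
        show "length (vs @ [x]) \<ge> 3" using len by simp
        show "distinct (vs @ [x])" using vs yx by (auto simp: path_in_def)
        show "adjacent T ((vs @ [x]) ! i) ((vs @ [x]) ! Suc i)"
          if "Suc i < length (vs @ [x])" for i
          using sx that by (auto simp: successively_conv_nth)
        show "adjacent T (last (vs @ [x])) (hd (vs @ [x]))"
          using vs yx by (auto simp: path_in_def adjacent_commute)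
      qed
      then show False using tree by (auto simp: is_tree_def)
    qed
    then have "grown T u (insert x A)"
      using adjacent_verts[OF simple yx(3)] by (intro leaf[OF A yx(1) _ yx(2,3)]) blast+
    from max[OF this] yx(2) show False by blast
  qed
  then show ?thesis using A by simp
qed

section \<open>Counting the copies of a tree through a vertex\<close>

text \<open>Homomorphisms rather than embeddings: they give an upper bound for the number of copies
  in which \<open>v\<close> plays the role of \<open>u\<close>.\<close>

definition homs :: "'a graph \<Rightarrow> 'b graph \<Rightarrow> 'a \<Rightarrow> 'b \<Rightarrow> 'a set \<Rightarrow> ('a \<Rightarrow> 'b) set" where
  "homs T G u v A = {\<phi> \<in> A \<rightarrow>\<^sub>E verts G. \<phi> u = v \<and>
     (\<forall>x\<in>A. \<forall>z\<in>A. adjacent T x z \<longrightarrow> adjacent G (\<phi> x) (\<phi> z))}"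

lemma finite_homs: "finite A \<Longrightarrow> finite (verts G) \<Longrightarrow> finite (homs T G u v A)"
  unfolding homs_def by (rule finite_subset[OF _ finite_PiE[of A "\<lambda>_. verts G"]]) auto

text \<open>The image of the root is prescribed, and each later leaf goes to one of at most
  \<open>\<Delta>\<close> neighbours of the image of its earlier neighbour.\<close>

lemma card_homs_le:
  assumes "grown T u A" and fin: "finite (verts G)"
    and deg: "\<And>v. v \<in> verts G \<Longrightarrow> card {w\<in>verts G. adjacent G v w} \<le> \<Delta>"
  shows "card (homs T G u v A) \<le> \<Delta> ^ (card A - 1)"
  using assms(1)
proof (induction rule: grown.induct)
  case root
  have "homs T G u v {u} \<subseteq> {\<lambda>x\<in>{u}. v}"
    by (auto simp: homs_def PiE_def extensional_def)
  then have "card (homs T G u v {u}) \<le> card {\<lambda>x\<in>{u}. v}" by (intro card_mono) auto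
  then show ?case by simp
next
  case (leaf A y x)
  have finA: "finite A" using grown_finite[OF leaf.hyps(1)] .
  have uA: "u \<in> A" using grown_root[OF leaf.hyps(1)] .
  define P where "P = (SIGMA \<phi>:homs T G u v A. {w\<in>verts G. adjacent G (\<phi> y) w})"
  have "card (homs T G u v (insert x A)) \<le> card P"
  proof (rule card_inj_on_le)
    show "inj_on (\<lambda>\<phi>. (restrict \<phi> A, \<phi> x)) (homs T G u v (insert x A))"
    proof (rule inj_onI)
      fix \<phi> \<psi> assume h: "\<phi> \<in> homs T G u v (insert x A)" "\<psi> \<in> homs T G u v (insert x A)"
        and eq: "(restrict \<phi> A, \<phi> x) = (restrict \<psi> A, \<psi> x)"
      show "\<phi> = \<psi>"
      proof (rule PiE_ext)
        show "\<phi> \<in> insert x A \<rightarrow>\<^sub>E verts G" "\<psi> \<in> insert x A \<rightarrow>\<^sub>E verts G"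
          using h by (auto simp: homs_def)
        show "\<phi> i = \<psi> i" if "i \<in> insert x A" for i
          using that eq by (cases "i = x") (auto dest: fun_cong[of _ _ i])
      qed
    qed
    show "(\<lambda>\<phi>. (restrict \<phi> A, \<phi> x)) ` homs T G u v (insert x A) \<subseteq> P"
      using leaf.hyps(2-5) uA by (auto simp: P_def homs_def)
    show "finite P" unfolding P_def using fin finA by (intro finite_SigmaI finite_homs) auto
  qed
  also have "card P = (\<Sum>\<phi>\<in>homs T G u v A. card {w\<in>verts G. adjacent G (\<phi> y) w})"
    unfolding P_def using fin finA by (intro card_SigmaI finite_homs) auto
  also have "\<dots> \<le> (\<Sum>\<phi>\<in>homs T G u v A. \<Delta>)"
    using leaf.hyps(2) by (intro sum_mono deg) (auto simp: homs_def)
  also have "\<dots> \<le> \<Delta> ^ (card A - 1) * \<Delta>" using leaf.IH by simp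
  also have "\<dots> = \<Delta> ^ (card (insert x A) - 1)"
  proof -
    \<comment> \<open>\<open>A\<close> contains the root, so \<open>card A - 1\<close> is not
      truncated and the exponent really grows by one.\<close>
    have "card A > 0" using uA finA by (auto simp: card_gt_0_iff)
    then show ?thesis using leaf.hyps(4) finA by (cases "card A") auto
  qed
  finally show ?case .
qed

text \<open>The homomorphism is the inverse of the isomorphism, and \<open>u\<close> is the image of
  \<open>v\<close> in \<open>T\<close>.\<close>

lemma isomorphic_hom:
  assumes H: "is_subgraph H G" "isomorphic H T" and v: "v \<in> verts H"
  shows "\<exists>u\<in>verts T. \<exists>\<phi>\<in>homs T G u v (verts T). verts H = \<phi> ` verts T"
proof -
  obtain g where g: "bij_betw g (verts H) (verts T)"
    and adj: "\<And>a b. a \<in> verts H \<Longrightarrow> b \<in> verts H \<Longrightarrow> adjacent H a b \<longleftrightarrow> adjacent T (g a) (g b)"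
    using H(2) by (auto simp: isomorphic_def)
  define i where "i = inv_into (verts H) g"
  have i: "i x \<in> verts H" "g (i x) = x" if "x \<in> verts T" for x
    using that g by (auto simp: i_def bij_betw_def inv_into_into f_inv_into_f)
  have im: "i ` verts T = verts H"
    using bij_betw_inv_into[OF g] by (simp add: i_def bij_betw_def)
  have ig: "i (g v) = v" using g v by (simp add: i_def bij_betw_def)
  have gv: "g v \<in> verts T" using g v by (auto simp: bij_betw_def)
  have "adjacent G (i x) (i z)" if "x \<in> verts T" "z \<in> verts T" "adjacent T x z" for x z
  proof -
    have "adjacent H (i x) (i z)" using adj[of "i x" "i z"] i that by simp
    then show ?thesis using H(1) by (auto simp: is_subgraph_def adjacent_def)
  qed
  then have "restrict i (verts T) \<in> homs T G (g v) v (verts T)"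
    using i(1) H(1) gv ig by (auto simp: homs_def is_subgraph_def)
  moreover have "verts H = restrict i (verts T) ` verts T" using im by simp
  ultimately show ?thesis using gv by blast
qed

text \<open>The vertex sets of copies form a \<open>t\<close>-uniform hypergraph. Choosing the role
  \<open>u\<close> of \<open>v\<close> in \<open>T\<close> and then a homomorphism shows that
  \<open>v\<close> lies in at most \<open>t * \<Delta> ^ (t - 1)\<close> of its edges, so the
  counting method applies.\<close>

lemma unique_chromatic_number_le:
  fixes \<beta> :: real
  assumes tree: "is_tree T" and t: "card (verts T) = t" "t \<ge> 1"
    and fin: "finite (verts G)"
    and deg: "\<And>v. v \<in> verts G \<Longrightarrow> card {w\<in>verts G. adjacent G v w} \<le> \<Delta>"
    and \<beta>: "\<beta> \<ge> 1" "2 * \<beta> \<le> real k"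
      "real (t * \<Delta> ^ (t - 1) * t ^ t) \<le> \<beta> ^ ((t + 1) div 2)"
  shows "unique_chromatic_number T G \<le> k"
proof -
  have finT: "finite (verts T)" using t by (simp add: card_ge_0_finite)
  define E where "E = {verts H | H. is_subgraph H G \<and> isomorphic H T}"
  have "\<exists>f \<in> verts G \<rightarrow> {1..k}. \<forall>e\<in>E. has_unique_colour f e"
  proof (rule ex_colouring_with_unique_colours[OF fin _ _ t(2) _ \<beta>])
    show "e \<subseteq> verts G" if "e \<in> E" for e using that by (auto simp: E_def is_subgraph_def)
    show "card e = t" if "e \<in> E" for e
      using that t by (auto simp: E_def isomorphic_def bij_betw_same_card)
    show "card {e\<in>E. v \<in> e} \<le> t * \<Delta> ^ (t - 1)" if "v \<in> verts G" for v
    proof -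
      have "{e\<in>E. v \<in> e} \<subseteq> (\<Union>u\<in>verts T. (\<lambda>\<phi>. \<phi> ` verts T) ` homs T G u v (verts T))"
        using isomorphic_hom by (fastforce simp: E_def)
      then have "card {e\<in>E. v \<in> e}
          \<le> card (\<Union>u\<in>verts T. (\<lambda>\<phi>. \<phi> ` verts T) ` homs T G u v (verts T))"
        using finT fin by (intro card_mono finite_UN_I finite_imageI finite_homs)
      also have "\<dots> \<le> (\<Sum>u\<in>verts T. card ((\<lambda>\<phi>. \<phi> ` verts T) ` homs T G u v (verts T)))"
        using finT by (rule card_UN_le)
      also have "\<dots> \<le> (\<Sum>u\<in>verts T. \<Delta> ^ (t - 1))"
      proof (rule sum_mono)
        fix u assume u: "u \<in> verts T"
        have "card ((\<lambda>\<phi>. \<phi> ` verts T) ` homs T G u v (verts T)) \<le> card (homs T G u v (verts T))"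
          using finT fin by (intro card_image_le finite_homs)
        also have "\<dots> \<le> \<Delta> ^ (t - 1)"
          using card_homs_le[OF tree_grown[OF tree finT u] fin deg, of v] t by simp
        finally show "card ((\<lambda>\<phi>. \<phi> ` verts T) ` homs T G u v (verts T)) \<le> \<Delta> ^ (t - 1)" .
      qed
      also have "\<dots> = t * \<Delta> ^ (t - 1)" using t by simp
      finally show ?thesis .
    qed
  qed
  then obtain f where f: "f \<in> verts G \<rightarrow> {1..k}" "\<And>e. e \<in> E \<Longrightarrow> has_unique_colour f e" by blast
  have "unique_colouring T G k f"
    using f unfolding unique_colouring_def has_unique_colour_def E_def by blast
  then show ?thesis unfolding unique_chromatic_number_def by (intro Least_le) blast
qed

section \<open>Embedding trees into joined graphs\<close>

text \<open>Known as the absence of a bipartite hole of size \<open>s\<close>: the complement graph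
  contains no complete bipartite graph with \<open>s\<close> vertices on each side.\<close>

definition joined :: "nat \<Rightarrow> 'a graph \<Rightarrow> bool" where
  "joined s G \<longleftrightarrow> (\<forall>X Y. X \<subseteq> verts G \<and> Y \<subseteq> verts G \<and> X \<inter> Y = {} \<and> card X = s \<and> card Y = s
     \<longrightarrow> (\<exists>x\<in>X. \<exists>y\<in>Y. adjacent G x y))"

text \<open>The leaf added last is removed first: its neighbour \<open>y\<close> keeps only those candidates in
  \<open>W y\<close> that have a neighbour in the candidate set of the leaf, which loses fewer than \<open>s\<close> of
  them.\<close>

lemma joined_embedding:
  assumes "grown T u A" and simple: "simple_graph T" and fin: "finite (verts G)"
    and G: "joined s G"
    and "\<And>x. x \<in> A \<Longrightarrow> W x \<subseteq> verts G" "\<And>x. x \<in> A \<Longrightarrow> card (W x) \<ge> card A * s"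
    and "\<And>x z. x \<in> A \<Longrightarrow> z \<in> A \<Longrightarrow> x \<noteq> z \<Longrightarrow> W x \<inter> W z = {}" and s: "s \<ge> 1"
  shows "\<exists>\<phi>. (\<forall>x\<in>A. \<phi> x \<in> W x) \<and>
    (\<forall>x\<in>A. \<forall>z\<in>A. adjacent T x z \<longrightarrow> adjacent G (\<phi> x) (\<phi> z))"
  using assms(1,5,6,7)
proof (induction arbitrary: W rule: grown.induct)
  case root
  have "W u \<noteq> {}" using root.prems(2)[of u] s by auto
  then show ?case using not_adjacent_self[OF simple, of u] by auto
next
  case (leaf A y x)
  have finA: "finite A" using grown_finite[OF leaf.hyps(1)] .
  have cA: "card (insert x A) = Suc (card A)" using finA leaf.hyps(4) by simp
  define W' where "W' = W(y := {w\<in>W y. \<exists>x'\<in>W x. adjacent G w x'})"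
  have W'sub: "W' z \<subseteq> W z" for z by (auto simp: W'_def)
  have finW: "finite (W z)" if "z \<in> insert x A" for z
    using leaf.prems(1)[OF that] fin finite_subset by blast
  \<comment> \<open>Otherwise \<open>s\<close> discarded candidates and \<open>s\<close> candidates
    of the leaf would be disjoint sets with no edge between them.\<close>
  have few: "card (W y - W' y) < s"
  proof (rule ccontr)
    assume "\<not> card (W y - W' y) < s"
    then obtain X where X: "X \<subseteq> W y - W' y" "card X = s"
      by (meson not_less obtain_subset_with_card_n)
    have "s \<le> card (W x)" using leaf.prems(2)[of x] cA by simp
    then obtain Y where Y: "Y \<subseteq> W x" "card Y = s" by (meson obtain_subset_with_card_n)
    have "W y \<inter> W x = {}" using leaf.hyps(2,4) by (intro leaf.prems(3)) auto
    then have "X \<inter> Y = {}" using X Y by blast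
    moreover have "X \<subseteq> verts G" "Y \<subseteq> verts G"
      using X Y leaf.prems(1)[of y] leaf.prems(1)[of x] leaf.hyps(2) by blast+
    ultimately obtain a b where "a \<in> X" "b \<in> Y" "adjacent G a b"
      using G X Y unfolding joined_def by blast
    then show False using X Y by (auto simp: W'_def)
  qed
  \<comment> \<open>Deleting the leaf lowers the required size by exactly \<open>s\<close>, which
    pays for the candidates lost at \<open>y\<close>.\<close>
  have big: "card A * s \<le> card (W' z)" if z: "z \<in> A" for z
  proof (cases "z = y")
    case True
    have "card (W y - W' y) = card (W y) - card (W' y)"
      using W'sub finW[of y] leaf.hyps(2) by (intro card_Diff_subset) (auto intro: finite_subset)
    then show ?thesis using few leaf.prems(2)[of y] cA leaf.hyps(2) True by simp
  next
    case False
    then show ?thesis using leaf.prems(2)[of z] z cA by (simp add: W'_def)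
  qed
  have "\<exists>\<phi>. (\<forall>x\<in>A. \<phi> x \<in> W' x) \<and>
    (\<forall>x\<in>A. \<forall>z\<in>A. adjacent T x z \<longrightarrow> adjacent G (\<phi> x) (\<phi> z))"
  proof (rule leaf.IH[OF _ big])
    show "W' z \<subseteq> verts G" if "z \<in> A" for z using W'sub leaf.prems(1)[of z] that by blast
    show "W' z \<inter> W' w = {}" if "z \<in> A" "w \<in> A" "z \<noteq> w" for z w
      using W'sub[of z] W'sub[of w] leaf.prems(3)[of z w] that by blast
  qed
  then obtain \<phi> where \<phi>: "\<And>z. z \<in> A \<Longrightarrow> \<phi> z \<in> W' z"
    "\<And>z w. z \<in> A \<Longrightarrow> w \<in> A \<Longrightarrow> adjacent T z w \<Longrightarrow> adjacent G (\<phi> z) (\<phi> w)" by blast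
  obtain x' where x': "x' \<in> W x" "adjacent G (\<phi> y) x'"
    using \<phi>(1)[OF leaf.hyps(2)] by (auto simp: W'_def)
  \<comment> \<open>By the uniqueness premise of \<open>leaf\<close>, \<open>y\<close> is the only
    neighbour of \<open>x\<close> in \<open>A\<close>, so one new edge suffices.\<close>
  have new: "adjacent G (\<phi> z) x'" if "z \<in> A" "adjacent T z x" for z
    using that leaf.hyps(6) x'(2) by blast
  have "adjacent G ((\<phi>(x := x')) z) ((\<phi>(x := x')) w)"
    if "z \<in> insert x A" "w \<in> insert x A" "adjacent T z w" for z w
    using that \<phi>(2) new[of z] new[of w] leaf.hyps(4) not_adjacent_self[OF simple, of x]
      adjacent_commute[of T x w] adjacent_commute[of G x' "\<phi> w"]
    by (cases "z = x"; cases "w = x") auto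
  moreover have "(\<phi>(x := x')) z \<in> W z" if "z \<in> insert x A" for z
    using that \<phi>(1)[of z] W'sub[of z] x'(1) by (cases "z = x") auto
  ultimately show ?case by blast
qed

section \<open>Large colour classes contain monochromatic copies\<close>

lemma ex_disjoint_subsets:
  assumes "finite A" "finite U" "card A * m \<le> card U"
  shows "\<exists>W. (\<forall>x\<in>A. W x \<subseteq> U \<and> card (W x) = m) \<and>
    (\<forall>x\<in>A. \<forall>z\<in>A. x \<noteq> z \<longrightarrow> W x \<inter> W z = {})"
  using assms
proof (induction A arbitrary: U rule: finite_induct)
  case (insert a A)
  have "m \<le> card U" using insert by simp
  then obtain M where M: "M \<subseteq> U" "card M = m" by (meson obtain_subset_with_card_n)
  then have "card (U - M) = card U - m"
    using insert.prems by (simp add: card_Diff_subset finite_subset)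
  then have "card A * m \<le> card (U - M)" using insert.prems insert.hyps by simp
  then obtain W where W: "\<forall>x\<in>A. W x \<subseteq> U - M \<and> card (W x) = m"
    "\<forall>x\<in>A. \<forall>z\<in>A. x \<noteq> z \<longrightarrow> W x \<inter> W z = {}"
    using insert.IH[of "U - M"] insert.prems(1) by auto
  have "(W(a := M)) x \<subseteq> U \<and> card ((W(a := M)) x) = m" if "x \<in> insert a A" for x
    using W(1) M that by (cases "x = a") auto
  moreover have "(W(a := M)) x \<inter> (W(a := M)) z = {}"
    if "x \<in> insert a A" "z \<in> insert a A" "x \<noteq> z" for x z
  proof -
    have "W x \<inter> M = {}" if "x \<in> A" for x using W(1) that by blast
    then show ?thesis using that W(2) by (cases "x = a"; cases "z = a") (auto simp: Int_commute)
  qed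
  ultimately show ?case by (intro exI[of _ "W(a := M)"]) blast
qed simp

text \<open>Copies need not be induced: \<open>H\<close> takes exactly the images of the edges of
  \<open>T\<close>, so the inverse of \<open>\<phi>\<close> is an isomorphism whatever other edges
  \<open>G\<close> has.\<close>

lemma subgraph_of_embedding:
  assumes simple: "simple_graph T" and inj: "inj_on \<phi> (verts T)"
    and V: "\<phi> ` verts T \<subseteq> verts G"
    and hom: "\<And>x z. x \<in> verts T \<Longrightarrow> z \<in> verts T \<Longrightarrow> adjacent T x z \<Longrightarrow> adjacent G (\<phi> x) (\<phi> z)"
  shows "\<exists>H. is_subgraph H G \<and> isomorphic H T \<and> verts H = \<phi> ` verts T"
proof -
  define H where "H = Graph (\<phi> ` verts T) ((`) \<phi> ` edges T)"
  have e: "e \<subseteq> verts T" "card e = 2" if "e \<in> edges T" for e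
    using simple that by (auto simp: simple_graph_def)
  have "card (\<phi> ` e) = 2" if "e \<in> edges T" for e
    using e[OF that] inj by (metis card_image inj_on_subset)
  then have "simple_graph H"
    using e(1) by (auto simp: simple_graph_def H_def)
  moreover have "edges H \<subseteq> edges G"
  proof
    fix e' assume "e' \<in> edges H"
    then obtain e0 where e0: "e0 \<in> edges T" "e' = \<phi> ` e0" by (auto simp: H_def)
    then obtain a b where ab: "e0 = {a, b}" using e(2)[OF e0(1)] by (meson card_2_iff)
    then show "e' \<in> edges G" using hom[of a b] e(1)[OF e0(1)] e0 by (simp add: adjacent_def)
  qed
  ultimately have "is_subgraph H G" using V by (simp add: is_subgraph_def H_def)
  moreover have "isomorphic H T"
    unfolding isomorphic_def
  proof (intro exI conjI ballI)
    show "bij_betw (inv_into (verts T) \<phi>) (verts H) (verts T)"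
      using inj by (simp add: H_def bij_betw_inv_into inj_on_imp_bij_betw)
    fix a b assume "a \<in> verts H" "b \<in> verts H"
    then obtain x z where xz: "x \<in> verts T" "z \<in> verts T" "a = \<phi> x" "b = \<phi> z"
      by (auto simp: H_def)
    have "{a, b} \<in> (`) \<phi> ` edges T \<longleftrightarrow> {x, z} \<in> edges T"
    proof
      assume "{a, b} \<in> (`) \<phi> ` edges T"
      then obtain e0 where e0: "e0 \<in> edges T" "\<phi> ` {x, z} = \<phi> ` e0" using xz by auto
      \<comment> \<open>An injective map separates subsets of its domain, so no other edge of
        \<open>T\<close> has image \<open>{a, b}\<close>.\<close>
      then have "{x, z} = e0" using inj_on_image_eq_iff[OF inj, of "{x, z}" e0] xz e(1)[OF e0(1)] by simp
      then show "{x, z} \<in> edges T" using e0 by simp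
    next
      assume "{x, z} \<in> edges T"
      then show "{a, b} \<in> (`) \<phi> ` edges T" using xz by (intro image_eqI[of _ _ "{x, z}"]) auto
    qed
    then show "adjacent H a b \<longleftrightarrow>
        adjacent T (inv_into (verts T) \<phi> a) (inv_into (verts T) \<phi> b)"
      using xz inj by (simp add: adjacent_def H_def)
  qed
  ultimately show ?thesis by (intro exI[of _ H]) (simp add: H_def)
qed

text \<open>A class of size \<open>t * (t * s)\<close> would split into \<open>t\<close> disjoint
  blocks of size \<open>t * s\<close>, one per vertex of \<open>T\<close>. Then
  \<open>joined_embedding\<close> finds a monochromatic copy, which has no unique colour because
  \<open>t \<ge> 2\<close>.\<close>

lemma card_colour_class_less:
  assumes tree: "is_tree T" and t: "card (verts T) = t" "t \<ge> 2"
    and fin: "finite (verts G)" and G: "joined s G" and s: "s \<ge> 1"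
    and f: "unique_colouring T G k f"
  shows "card {v\<in>verts G. f v = c} < t * (t * s)"
proof (rule ccontr)
  assume ge: "\<not> ?thesis"
  define U where "U = {v\<in>verts G. f v = c}"
  have finT: "finite (verts T)" using t by (simp add: card_ge_0_finite)
  have simple: "simple_graph T" using tree by (simp add: is_tree_def)
  obtain u where u: "u \<in> verts T" using t by fastforce
  have "finite U" "card (verts T) * (t * s) \<le> card U" using ge t fin by (auto simp: U_def)
  from ex_disjoint_subsets[OF finT this]
  obtain W where W0: "\<forall>x\<in>verts T. W x \<subseteq> U \<and> card (W x) = t * s"
    "\<forall>x\<in>verts T. \<forall>z\<in>verts T. x \<noteq> z \<longrightarrow> W x \<inter> W z = {}"
    by auto
  have W: "W x \<subseteq> U" "card (W x) = t * s" if "x \<in> verts T" for x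
    using W0(1) that by auto
  have Wdisj: "W x \<inter> W z = {}" if "x \<in> verts T" "z \<in> verts T" "x \<noteq> z" for x z
    using W0(2) that by simp
  have "\<exists>\<phi>. (\<forall>x\<in>verts T. \<phi> x \<in> W x) \<and>
    (\<forall>x\<in>verts T. \<forall>z\<in>verts T. adjacent T x z \<longrightarrow> adjacent G (\<phi> x) (\<phi> z))"
  proof (rule joined_embedding[OF tree_grown[OF tree finT u] simple fin G _ _ Wdisj s])
    show "W x \<subseteq> verts G" if "x \<in> verts T" for x using W(1)[OF that] by (auto simp: U_def)
    show "card (verts T) * s \<le> card (W x)" if "x \<in> verts T" for x using W(2)[OF that] t by simp
  qed
  then obtain \<phi> where \<phi>: "\<And>x. x \<in> verts T \<Longrightarrow> \<phi> x \<in> W x"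
    "\<And>x z. x \<in> verts T \<Longrightarrow> z \<in> verts T \<Longrightarrow> adjacent T x z \<Longrightarrow> adjacent G (\<phi> x) (\<phi> z)" by blast
  have inj: "inj_on \<phi> (verts T)"
  proof (rule inj_onI, rule ccontr)
    fix x z assume "x \<in> verts T" "z \<in> verts T" "\<phi> x = \<phi> z" "x \<noteq> z"
    then show False using \<phi>(1)[of x] \<phi>(1)[of z] Wdisj[of x z] by auto
  qed
  have inU: "\<phi> ` verts T \<subseteq> U" using \<phi>(1) W(1) by blast
  then have "\<phi> ` verts T \<subseteq> verts G" by (auto simp: U_def)
  then obtain H where H: "is_subgraph H G" "isomorphic H T" "verts H = \<phi> ` verts T"
    using subgraph_of_embedding[OF simple inj _ \<phi>(2)] by blast
  then obtain d where d: "\<exists>!v. v \<in> verts H \<and> f v = d" using f unfolding unique_colouring_def by blast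
  have "f v = c" if "v \<in> verts H" for v using that H(3) inU by (auto simp: U_def)
  then have "\<exists>!v. v \<in> verts H" using d by metis
  then obtain w where "verts H = {w}" by blast
  then have "card (verts H) = 1" by simp
  then show False using H(3) card_image[OF inj] t by simp
qed

lemma card_verts_le_unique_chromatic_number:
  assumes tree: "is_tree T" and t: "card (verts T) = t" "t \<ge> 2"
    and fin: "finite (verts G)" and G: "joined s G" and s: "s \<ge> 1"
  shows "card (verts G) \<le> unique_chromatic_number T G * (t * (t * s))"
proof -
  have "verts T \<noteq> {}" using t by auto
  from ex_unique_colouring[OF fin this]
  have "\<exists>f. unique_colouring T G (unique_chromatic_number T G) f"
    unfolding unique_chromatic_number_def by (rule LeastI_ex)
  then obtain f where f: "unique_colouring T G (unique_chromatic_number T G) f" ..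
  define k where "k = unique_chromatic_number T G"
  have "verts G \<subseteq> (\<Union>c\<in>{1..k}. {v\<in>verts G. f v = c})"
    using f by (auto simp: unique_colouring_def k_def Pi_def)
  then have "card (verts G) \<le> card (\<Union>c\<in>{1..k}. {v\<in>verts G. f v = c})"
    using fin by (intro card_mono) auto
  also have "\<dots> \<le> (\<Sum>c\<in>{1..k}. card {v\<in>verts G. f v = c})" by (rule card_UN_le) simp
  also have "\<dots> \<le> (\<Sum>c\<in>{1..k}. t * (t * s))"
    using card_colour_class_less[OF tree t fin G s f] by (intro sum_mono less_imp_le)
  finally show ?thesis by (simp add: k_def)
qed

section \<open>Tail bounds for the random graph\<close>

lemma finite_possible_edges: "finite (possible_edges n)"
  unfolding possible_edges_def by (rule finite_subset[of _ "Pow {1..n}"]) auto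

text \<open>The parameter \<open>c\<close> covers both later uses, all edges of \<open>F\<close>
  present or all absent. The event is a product event, so independence evaluates it.\<close>

lemma prob_Pi_bernoulli_const:
  assumes "finite A" "F \<subseteq> A" "0 \<le> q" "q \<le> 1"
  shows "measure_pmf.prob (Pi_pmf A False (\<lambda>_. bernoulli_pmf q)) {b. \<forall>e\<in>F. b e = c}
    = (if c then q else 1 - q) ^ card F"
proof -
  have "{b. \<forall>e\<in>F. b e = c} = Pi A (\<lambda>e. if e \<in> F then {c} else UNIV)"
    using assms(2) by (auto simp: Pi_def)
  then have "measure_pmf.prob (Pi_pmf A False (\<lambda>_. bernoulli_pmf q)) {b. \<forall>e\<in>F. b e = c}
      = (\<Prod>e\<in>A. measure_pmf.prob (bernoulli_pmf q) (if e \<in> F then {c} else UNIV))"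
    using assms(1) by (simp add: measure_Pi_pmf_Pi)
  also have "\<dots> = (\<Prod>e\<in>A. if e \<in> F then (if c then q else 1 - q) else 1)"
    using assms(3,4) by (intro prod.cong) (auto simp: measure_pmf_single)
  also have "\<dots> = (if c then q else 1 - q) ^ card (A \<inter> F)"
    using assms(1) by (simp add: prod.If_cases Int_def)
  finally show ?thesis using assms(2) by (simp add: Int_absorb1)
qed

lemma prob_erdos_renyi_subset_edges:
  assumes "F \<subseteq> possible_edges n" "0 \<le> q" "q \<le> 1"
  shows "measure_pmf.prob (erdos_renyi n q) {G. F \<subseteq> edges G} = q ^ card F"
proof -
  have "(\<lambda>b. Graph {1..n} {e \<in> possible_edges n. b e}) -` {G. F \<subseteq> edges G}
      = {b. \<forall>e\<in>F. b e = True}" using assms(1) by auto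
  then show ?thesis
    using prob_Pi_bernoulli_const[OF finite_possible_edges assms, of True]
    by (simp add: erdos_renyi_def)
qed

lemma prob_erdos_renyi_disjoint_edges:
  assumes "F \<subseteq> possible_edges n" "0 \<le> q" "q \<le> 1"
  shows "measure_pmf.prob (erdos_renyi n q) {G. F \<inter> edges G = {}} = (1 - q) ^ card F"
proof -
  have "(\<lambda>b. Graph {1..n} {e \<in> possible_edges n. b e}) -` {G. F \<inter> edges G = {}}
      = {b. \<forall>e\<in>F. b e = False}" using assms(1) by auto
  then show ?thesis
    using prob_Pi_bernoulli_const[OF finite_possible_edges assms, of False]
    by (simp add: erdos_renyi_def)
qed

lemma erdos_renyi_support:
  assumes "G \<in> set_pmf (erdos_renyi n q)"
  shows "verts G = {1..n}" "edges G \<subseteq> possible_edges n"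
  using assms by (auto simp: erdos_renyi_def)

text \<open>The cover is required on the support only, so facts valid for every sampled graph can be
  used to find the index.\<close>

lemma prob_le_union_bound:
  fixes M :: "'a pmf"
  assumes "finite I" "\<And>x. x \<in> set_pmf M \<Longrightarrow> x \<in> A \<Longrightarrow> \<exists>i\<in>I. x \<in> B i"
    and "\<And>i. i \<in> I \<Longrightarrow> measure_pmf.prob M (B i) \<le> r"
  shows "measure_pmf.prob M A \<le> real (card I) * r"
proof -
  have "measure_pmf.prob M A = measure_pmf.prob M (A \<inter> set_pmf M)"
    by (simp add: measure_Int_set_pmf)
  also have "\<dots> \<le> measure_pmf.prob M (\<Union>i\<in>I. B i)"
    using assms(2) by (intro measure_pmf.finite_measure_mono) auto
  also have "\<dots> \<le> (\<Sum>i\<in>I. measure_pmf.prob M (B i))"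
    using assms(1) by (intro measure_UNION_le) auto
  also have "\<dots> \<le> (\<Sum>i\<in>I. r)" using assms(3) by (rule sum_mono)
  finally show ?thesis by simp
qed

text \<open>A vertex of degree at least \<open>m\<close> is the centre of a star with
  \<open>m\<close> edges; the union bound runs over the centre and the set of leaves.\<close>

lemma prob_large_degree_le:
  assumes q: "0 \<le> q" "q \<le> 1"
  shows "measure_pmf.prob (erdos_renyi n q)
      {G. \<exists>v\<in>verts G. m \<le> card {w\<in>verts G. adjacent G v w}} \<le> real n * (real (n choose m) * q ^ m)"
proof -
  define I where "I = (SIGMA v:{1..n}. {Y. Y \<subseteq> {1..n} - {v} \<and> card Y = m})"
  define F where "F = (\<lambda>(v, Y). (\<lambda>w. {v, w}) ` Y :: nat set set)"
  have finI: "finite I" unfolding I_def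
    by (intro finite_SigmaI finite_subset[of "{Y. Y \<subseteq> _ - {_} \<and> card Y = m}" "Pow {1..n}"]) auto
  have "measure_pmf.prob (erdos_renyi n q)
      {G. \<exists>v\<in>verts G. m \<le> card {w\<in>verts G. adjacent G v w}} \<le> real (card I) * q ^ m"
  proof (rule prob_le_union_bound[OF finI, where B = "\<lambda>i. {G. F i \<subseteq> edges G}"])
    fix G assume G: "G \<in> set_pmf (erdos_renyi n q)"
      and "G \<in> {G. \<exists>v\<in>verts G. m \<le> card {w\<in>verts G. adjacent G v w}}"
    then obtain v where v: "v \<in> {1..n}" "m \<le> card {w\<in>verts G. adjacent G v w}"
      using erdos_renyi_support(1)[OF G] by auto
    then obtain Y where Y: "Y \<subseteq> {w\<in>verts G. adjacent G v w}" "card Y = m"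
      by (meson obtain_subset_with_card_n)
    have "\<not> adjacent G v v"
      using erdos_renyi_support(2)[OF G] by (auto simp: adjacent_def possible_edges_def)
    then have "Y \<subseteq> {1..n} - {v}" using Y(1) erdos_renyi_support(1)[OF G] by auto
    then have "(v, Y) \<in> I" using v Y by (simp add: I_def)
    moreover have "F (v, Y) \<subseteq> edges G" using Y(1) by (auto simp: F_def adjacent_def)
    ultimately show "\<exists>i\<in>I. G \<in> {G. F i \<subseteq> edges G}" by blast
  next
    fix i assume i: "i \<in> I"
    obtain v Y where vY: "i = (v, Y)" "v \<in> {1..n}" "Y \<subseteq> {1..n} - {v}" "card Y = m"
      using i by (auto simp: I_def)
    have "inj_on (\<lambda>w. {v, w}) Y" by (auto simp: inj_on_def doubleton_eq_iff)
    then have "card (F i) = m" using vY by (simp add: F_def card_image)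
    moreover have "F i \<subseteq> possible_edges n"
      using vY by (auto simp: F_def possible_edges_def card_insert_if)
    ultimately show "measure_pmf.prob (erdos_renyi n q) {G. F i \<subseteq> edges G} \<le> q ^ m"
      using prob_erdos_renyi_subset_edges[OF _ q] by simp
  qed
  also have "\<dots> \<le> real n * real (n choose m) * q ^ m"
  proof (rule mult_right_mono)
    have "card I = (\<Sum>v\<in>{1..n}. (n - 1) choose m)"
      unfolding I_def by (simp add: card_SigmaI n_subsets)
    also have "\<dots> \<le> n * (n choose m)" by (simp add: binomial_right_mono)
    finally show "real (card I) \<le> real n * real (n choose m)" by (simp flip: of_nat_mult)
  qed (use q in simp)
  finally show ?thesis by (simp add: mult.assoc)
qed

text \<open>A failing pair of disjoint \<open>s\<close>-sets has all its \<open>s * s\<close>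
  potential edges absent, and there are at most \<open>n ^ s\<close> choices for each set.\<close>

lemma prob_not_joined_le:
  assumes q: "0 \<le> q" "q \<le> 1"
  shows "measure_pmf.prob (erdos_renyi n q) {G. \<not> joined s G}
    \<le> (real n ^ s)\<^sup>2 * (1 - q) ^ (s * s)"
proof -
  define P where "P = {X. X \<subseteq> {1..n} \<and> card X = s}"
  define I where "I = {(X, Y). X \<in> P \<and> Y \<in> P \<and> X \<inter> Y = {}}"
  define F where "F = (\<lambda>(X, Y). (\<lambda>(x, y). {x, y}) ` (X \<times> Y) :: nat set set)"
  have finP: "finite P" unfolding P_def by (rule finite_subset[of _ "Pow {1..n}"]) auto
  have Isub: "I \<subseteq> P \<times> P" by (auto simp: I_def)
  have finI: "finite I" using finite_subset[OF Isub] finP by simp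
  have "measure_pmf.prob (erdos_renyi n q) {G. \<not> joined s G} \<le> real (card I) * (1 - q) ^ (s * s)"
  proof (rule prob_le_union_bound[OF finI, where B = "\<lambda>i. {G. F i \<inter> edges G = {}}"])
    fix G assume G: "G \<in> set_pmf (erdos_renyi n q)" and "G \<in> {G. \<not> joined s G}"
    then obtain X Y where XY: "X \<in> P" "Y \<in> P" "X \<inter> Y = {}"
      "\<And>x y. x \<in> X \<Longrightarrow> y \<in> Y \<Longrightarrow> \<not> adjacent G x y"
      using erdos_renyi_support(1)[OF G] unfolding joined_def P_def by auto
    then have "(X, Y) \<in> I" "F (X, Y) \<inter> edges G = {}"
      by (auto simp: I_def F_def adjacent_def)
    then show "\<exists>i\<in>I. G \<in> {G. F i \<inter> edges G = {}}" by blast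
  next
    fix i assume "i \<in> I"
    then obtain X Y where XY: "i = (X, Y)" "X \<subseteq> {1..n}" "Y \<subseteq> {1..n}" "X \<inter> Y = {}"
      "card X = s" "card Y = s" by (auto simp: I_def P_def)
    \<comment> \<open>Disjointness keeps an edge from arising from two ordered pairs, so there are
      \<open>s * s\<close> distinct edges.\<close>
    have "inj_on (\<lambda>(x, y). {x, y}) (X \<times> Y)"
      using XY(4) by (auto simp: inj_on_def doubleton_eq_iff)
    then have "card (F i) = s * s" using XY by (simp add: F_def card_image card_cartesian_product)
    moreover have "F i \<subseteq> possible_edges n"
      using XY by (auto simp: F_def possible_edges_def card_insert_if)
    ultimately show "measure_pmf.prob (erdos_renyi n q) {G. F i \<inter> edges G = {}} \<le> (1 - q) ^ (s * s)"
      using prob_erdos_renyi_disjoint_edges[OF _ q] by simp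
  qed
  also have "\<dots> \<le> (real n ^ s)\<^sup>2 * (1 - q) ^ (s * s)"
  proof (rule mult_right_mono)
    have "(n choose s) * 1 \<le> (n choose s) * fact s" by (intro mult_left_mono fact_ge_1) auto
    then have ch: "n choose s \<le> n ^ s" using binomial_fact_pow[of n s] by linarith
    have "card I \<le> card (P \<times> P)" using Isub finP by (intro card_mono) auto
    also have "\<dots> = (n choose s)\<^sup>2"
      unfolding P_def by (simp add: card_cartesian_product n_subsets power2_eq_square)
    also have "\<dots> \<le> (n ^ s)\<^sup>2" using ch by (rule power_mono) simp
    finally show "real (card I) \<le> (real n ^ s)\<^sup>2" by (metis of_nat_le_iff of_nat_power)
  qed (use q in simp)
  finally show ?thesis .
qed

section \<open>Analytic estimates for the two failure probabilities\<close>

text \<open>A single term of the exponential series, all of whose terms are nonnegative. At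
  \<open>x = k\<close> it is a weak form of Stirling's bound.\<close>

lemma power_over_fact_le_exp:
  fixes x :: real
  assumes "x \<ge> 0"
  shows "x ^ k / fact k \<le> exp x"
proof -
  have s: "(\<lambda>n. x ^ n /\<^sub>R fact n) sums exp x" by (rule exp_converges)
  have "(\<Sum>n\<in>{k}. x ^ n /\<^sub>R fact n) \<le> (\<Sum>n. x ^ n /\<^sub>R fact n)"
    using s assms by (intro sum_le_suminf) (auto simp: sums_iff)
  then show ?thesis using s by (simp add: sums_iff field_simps)
qed

text \<open>The left side is at most \<open>(m / 8) ^ m / fact m\<close>, hence at most
  \<open>exp m / 8 ^ m\<close>. The factor 8 is chosen to exceed \<open>exp 2\<close>, which leaves
  \<open>exp (- m)\<close>.\<close>

lemma binomial_tail_le: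
  fixes q :: real
  assumes q: "0 < q" and m: "8 * (real n * q) \<le> real m"
  shows "real (n choose m) * q ^ m \<le> exp (- (real n * q))"
proof -
  have "real (n choose m) * fact m \<le> real n ^ m"
    using binomial_fact_pow[of n m] by (metis of_nat_fact of_nat_le_iff of_nat_mult of_nat_power)
  then have "real (n choose m) \<le> real n ^ m / fact m" by (simp add: field_simps)
  then have "real (n choose m) * q ^ m \<le> real n ^ m / fact m * q ^ m"
    using q by (intro mult_right_mono) auto
  also have "\<dots> = (real n * q) ^ m / fact m" by (simp add: power_mult_distrib)
  also have "\<dots> \<le> (real m / 8) ^ m / fact m"
    using q m by (intro divide_right_mono power_mono) auto
  also have "\<dots> = (real m ^ m / fact m) / 8 ^ m" by (simp add: power_divide)
  also have "\<dots> \<le> exp (real m) / 8 ^ m"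
    by (intro divide_right_mono power_over_fact_le_exp) auto
  also have "\<dots> \<le> exp (real m) / exp (2 * real m)"
  proof -
    have "exp 2 = exp 1 * exp (1::real)" by (simp flip: exp_add)
    also have "\<dots> \<le> (272/100) * (272/100::real)"
      using e_less_272 by (intro mult_mono) auto
    also have "\<dots> \<le> 8" by simp
    finally have "exp (2::real) ^ m \<le> 8 ^ m" by (intro power_mono) auto
    then have "exp (2 * real m) \<le> 8 ^ m" by (simp flip: exp_of_nat2_mult)
    then show ?thesis by (intro divide_left_mono) auto
  qed
  also have "\<dots> = exp (- real m)" by (simp flip: exp_diff)
  also have "\<dots> \<le> exp (- (real n * q))"
  proof -
    have "0 \<le> real n * q" using q by simp
    then show ?thesis using m by simp
  qed
  finally show ?thesis .
qed

text \<open>With \<open>l = ln n\<close> the left side is at most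
  \<open>exp (2 * s * l - q * s * s)\<close>. The constant 4 makes the second term at least twice
  the first, and \<open>q \<le> 1\<close> gives \<open>s \<ge> l\<close>.\<close>

lemma disjoint_pairs_tail_le:
  fixes q :: real
  assumes q: "0 < q" "q \<le> 1" and n: "n \<ge> 1" and s: "4 * ln (real n) / q \<le> real s"
  shows "(real n ^ s)\<^sup>2 * (1 - q) ^ (s * s) \<le> exp (- (ln (real n))\<^sup>2)"
proof -
  define l where "l = ln (real n)"
  have l0: "l \<ge> 0" using n by (simp add: l_def)
  have qs: "4 * l \<le> q * real s" using s q by (simp add: l_def field_simps)
  also have "\<dots> \<le> 1 * real s" using q by (intro mult_right_mono) auto
  finally have ls: "l \<le> real s" using l0 by simp
  have "real n ^ s = exp (real s * l)" using n by (simp add: l_def exp_of_nat_mult)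
  then have "(real n ^ s)\<^sup>2 = exp (2 * real s * l)" by (simp add: power2_eq_square flip: exp_add)
  moreover have "(1 - q) ^ (s * s) \<le> exp (- q) ^ (s * s)"
    using q exp_ge_add_one_self[of "- q"] by (intro power_mono) auto
  moreover have "exp (- q) ^ (s * s) = exp (- (q * real s * real s))"
    by (simp add: algebra_simps flip: exp_of_nat_mult)
  ultimately have "(real n ^ s)\<^sup>2 * (1 - q) ^ (s * s)
      \<le> exp (2 * real s * l) * exp (- (q * real s * real s))"
    by (simp add: mult_left_mono)
  also have "\<dots> = exp (2 * real s * l - q * real s * real s)" by (simp flip: exp_add)
  also have "\<dots> \<le> exp (- l\<^sup>2)"
  proof -
    have "4 * l * real s \<le> q * real s * real s" using qs by (intro mult_right_mono) auto
    moreover have "l * l \<le> l * real s" using ls l0 by (intro mult_left_mono) auto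
    moreover have "0 \<le> l * real s" using l0 by simp
    ultimately show ?thesis by (simp add: power2_eq_square algebra_simps)
  qed
  finally show ?thesis by (simp add: l_def)
qed

section \<open>Bounds on the chromatic number\<close>

lemma le_unique_chromatic_number_if_joined:
  assumes tree: "is_tree T" and t: "card (verts T) = t" "t \<ge> 2"
    and V: "finite (verts G)" "card (verts G) = n" and n: "n \<ge> 3"
    and q: "0 < q" "q \<le> 1" and G: "joined (nat \<lceil>4 * ln (real n) / q\<rceil>) G"
  shows "1 / (5 * real t ^ 2) * (real n * q) / ln (real n) \<le> real (unique_chromatic_number T G)"
proof -
  define l where "l = ln (real n)"
  define s where "s = nat \<lceil>4 * l / q\<rceil>"
  \<comment> \<open>The bound \<open>n \<ge> 3\<close> is there to exceed \<open>exp 1\<close>, so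
    that \<open>ln n \<ge> 1\<close>.\<close>
  have "exp 1 \<le> real n" using n e_less_272 by linarith
  then have l1: "l \<ge> 1" using n by (simp add: l_def ln_ge_iff)
  have lq: "l / q \<ge> 1" using l1 q by (simp add: field_simps)
  \<comment> \<open>Since \<open>l / q \<ge> 1\<close>, rounding up turns the factor 4 into at most
    5, the 5 in the constant of the statement.\<close>
  have s: "real s \<le> 5 * (l / q)" "s \<ge> 1"
    using lq unfolding s_def by linarith+
  have "n \<le> unique_chromatic_number T G * (t * (t * s))"
    using card_verts_le_unique_chromatic_number[OF tree t V(1) G] s(2) V(2) by (simp add: s_def l_def)
  then have "real n \<le> real (unique_chromatic_number T G * (t * (t * s)))" by linarith
  also have "\<dots> = real (unique_chromatic_number T G) * (real t ^ 2 * real s)"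
    by (simp add: power2_eq_square)
  also have "\<dots> \<le> real (unique_chromatic_number T G) * (real t ^ 2 * (5 * (l / q)))"
    using s(1) by (intro mult_left_mono) auto
  finally show ?thesis using q l1 t by (simp add: l_def[symmetric] field_simps)
qed

lemma unique_chromatic_number_le_if_small_degrees:
  assumes tree: "is_tree T" and t: "card (verts T) = t" "t \<ge> 2"
    and V: "finite (verts G)" and d: "1 \<le> d"
    and deg: "\<And>v. v \<in> verts G \<Longrightarrow> card {w\<in>verts G. adjacent G v w} \<le> \<Delta>"
    and \<Delta>: "real \<Delta> \<le> 9 * d"
  shows "real (unique_chromatic_number T G)
    \<le> 3 * (real t ^ (t + 1) * 9 ^ (t - 1)) powr (2 / real t) * d powr (2 * (1 - 1 / real t))"
proof -
  define c where "c = real t ^ (t + 1) * 9 ^ (t - 1)"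
  define x where "x = c * d ^ (t - 1)"
  \<comment> \<open>The solution of \<open>\<beta> powr (t / 2) = x\<close>, where \<open>x\<close>
    bounds \<open>t * \<Delta> ^ (t - 1) * t ^ t\<close>. The exponent \<open>2 / t\<close> produces
    the final power \<open>2 * (1 - 1 / t)\<close> of \<open>d\<close>.\<close>
  define \<beta> where "\<beta> = x powr (2 / real t)"
  define k where "k = nat \<lceil>2 * \<beta>\<rceil>"
  have c1: "c \<ge> 1"
  proof -
    have "1 * 1 \<le> real t ^ (t + 1) * 9 ^ (t - 1)"
      using t by (intro mult_mono one_le_power) auto
    then show ?thesis by (simp add: c_def)
  qed
  have x1: "x \<ge> 1"
  proof -
    have "1 * 1 \<le> c * d ^ (t - 1)" using c1 d by (intro mult_mono one_le_power) auto
    then show ?thesis by (simp add: x_def)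
  qed
  have \<beta>1: "\<beta> \<ge> 1" using x1 t by (simp add: \<beta>_def ge_one_powr_ge_zero)
  \<comment> \<open>Rounding up costs at most 1, which \<open>\<beta> \<ge> 1\<close>
    absorbs.\<close>
  have k: "2 * \<beta> \<le> real k" "real k \<le> 3 * \<beta>" using \<beta>1 unfolding k_def by linarith+
  have "real (t * \<Delta> ^ (t - 1) * t ^ t) = real t ^ (t + 1) * real \<Delta> ^ (t - 1)" by simp
  also have "\<dots> \<le> real t ^ (t + 1) * (9 * d) ^ (t - 1)"
    using \<Delta> by (intro mult_left_mono power_mono) auto
  also have "\<dots> = x" by (simp add: x_def c_def power_mult_distrib)
  also have "x = \<beta> powr (real t / 2)" using x1 t by (simp add: \<beta>_def powr_powr)
  \<comment> \<open>\<open>(t + 1) div 2\<close> is \<open>t / 2\<close> rounded up, and a larger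
    exponent is harmless for \<open>\<beta> \<ge> 1\<close>.\<close>
  also have "\<dots> \<le> \<beta> powr real ((t + 1) div 2)"
    using \<beta>1 by (intro powr_mono) linarith+
  also have "\<dots> = \<beta> ^ ((t + 1) div 2)" using \<beta>1 by (simp add: powr_realpow)
  finally have "unique_chromatic_number T G \<le> k"
    using t by (intro unique_chromatic_number_le[OF tree t(1) _ V deg \<beta>1 k(1)]) auto
  then have "real (unique_chromatic_number T G) \<le> 3 * \<beta>" using k(2) by linarith
  also have "\<beta> = c powr (2 / real t) * (d ^ (t - 1)) powr (2 / real t)"
    using c1 d by (simp add: \<beta>_def x_def powr_mult)
  also have "(d ^ (t - 1)) powr (2 / real t) = d powr (real (t - 1) * (2 / real t))"
    using d by (simp add: powr_powr flip: powr_realpow)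
  also have "real (t - 1) * (2 / real t) = 2 * (1 - 1 / real t)"
    using t by (simp add: of_nat_diff field_simps)
  finally show ?thesis by (simp add: c_def)
qed

theorem theorem2:
  fixes p :: "nat \<Rightarrow> real" and t :: nat and T :: "'a graph"
  assumes "\<And>n. n \<ge> 1 \<Longrightarrow> 0 < p n \<and> p n < 1"
    and "t \<ge> 2"
    and "is_tree T" and "card (verts T) = t"
    and "p \<in> o(\<lambda>_. 1)"
    and "filterlim (\<lambda>n. real n * p n) at_top sequentially"
  shows "\<exists>D1>0. \<exists>D2>0. \<exists>D3>0. \<forall>\<^sub>F n in sequentially.
    measure_pmf.prob (erdos_renyi n (p n))
      {G. D1 * (real n * p n) / ln (real n) \<le> real (unique_chromatic_number T G) \<and>
          real (unique_chromatic_number T G)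
            \<le> D2 * (real n * p n) powr (2 * (1 - 1 / real t))}
    \<ge> 1 - exp (- D3 * (ln (real n))\<^sup>2) - real n * exp (- D3 * (real n * p n))"
proof -
  define D1 where "D1 = 1 / (5 * real t ^ 2)"
  define D2 where "D2 = 3 * (real t ^ (t + 1) * 9 ^ (t - 1)) powr (2 / real t)"
  define S where "S = (\<lambda>n. {G :: nat graph.
      D1 * (real n * p n) / ln (real n) \<le> real (unique_chromatic_number T G) \<and>
      real (unique_chromatic_number T G) \<le> D2 * (real n * p n) powr (2 * (1 - 1 / real t))})"
  \<comment> \<open>The witness for \<open>D3\<close> is 1; the factors \<open>- 1\<close> are kept
    so that the estimate has the shape of the goal.\<close>
  have bound: "1 - exp (- 1 * (ln (real n))\<^sup>2) - real n * exp (- 1 * (real n * p n))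
      \<le> measure_pmf.prob (erdos_renyi n (p n)) (S n)"
    if n: "n \<ge> 3" and d: "real n * p n \<ge> 1" for n
  proof -
    define d where "d = real n * p n"
    \<comment> \<open>The factor 8 is what \<open>binomial_tail_le\<close> requires; as
      \<open>d \<ge> 1\<close>, rounding up stays within the \<open>9 * d\<close> of the colouring
      bound.\<close>
    define m where "m = nat \<lceil>8 * d\<rceil>"
    define s where "s = nat \<lceil>4 * ln (real n) / p n\<rceil>"
    define A where "A = {G :: nat graph. \<exists>v\<in>verts G. m \<le> card {w\<in>verts G. adjacent G v w}}"
    define B where "B = {G :: nat graph. \<not> joined s G}"
    let ?P = "measure_pmf.prob (erdos_renyi n (p n))"
    have q: "0 < p n" "p n \<le> 1" using assms(1)[of n] n by auto
    have d1: "d \<ge> 1" using d by (simp add: d_def)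
    have m: "8 * d \<le> real m" "real m \<le> 9 * d" using d1 unfolding m_def by linarith+
    \<comment> \<open>Outside the two bad events, large degree and a failing pair, both
      deterministic bounds apply.\<close>
    have good: "G \<in> S n" if G: "G \<in> set_pmf (erdos_renyi n (p n))" "G \<notin> A \<union> B" for G
    proof -
      have V: "finite (verts G)" "card (verts G) = n" using erdos_renyi_support(1)[OF G(1)] by auto
      have J: "joined s G" using G(2) by (simp add: B_def)
      have deg: "card {w\<in>verts G. adjacent G v w} \<le> m" if "v \<in> verts G" for v
        using G(2) that by (force simp: A_def not_le)
      show ?thesis
        using le_unique_chromatic_number_if_joined[OF assms(3,4,2) V n q J[unfolded s_def]]
          unique_chromatic_number_le_if_small_degrees[OF assms(3,4,2) V(1) d1 deg m(2)]
        by (simp add: S_def D1_def D2_def d_def)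
    qed
    have "?P A \<le> real n * (real (n choose m) * p n ^ m)"
      unfolding A_def using q by (intro prob_large_degree_le) auto
    also have "\<dots> \<le> real n * exp (- d)"
      using binomial_tail_le[of "p n" n m] q m(1) unfolding d_def by (intro mult_left_mono) auto
    finally have A: "?P A \<le> real n * exp (- d)" .
    have "?P B \<le> (real n ^ s)\<^sup>2 * (1 - p n) ^ (s * s)"
      unfolding B_def using q by (intro prob_not_joined_le) auto
    also have "\<dots> \<le> exp (- (ln (real n))\<^sup>2)"
      using q n by (intro disjoint_pairs_tail_le) (auto simp: s_def real_nat_ceiling_ge)
    finally have B: "?P B \<le> exp (- (ln (real n))\<^sup>2)" .
    have "?P (- S n) = ?P (- S n \<inter> set_pmf (erdos_renyi n (p n)))"
      by (simp add: measure_Int_set_pmf)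
    also have "\<dots> \<le> ?P (A \<union> B)"
      using good by (intro measure_pmf.finite_measure_mono) auto
    also have "\<dots> \<le> ?P A + ?P B" by (intro measure_Un_le) auto
    finally have "?P (- S n) \<le> real n * exp (- d) + exp (- (ln (real n))\<^sup>2)" using A B by linarith
    moreover have "?P (- S n) = 1 - ?P (S n)"
      using measure_pmf.prob_compl[of "S n"] by (simp add: Compl_eq_Diff_UNIV)
    ultimately show ?thesis by (simp add: d_def)
  qed
  have "\<forall>\<^sub>F n in sequentially. real n * p n \<ge> 1"
    using assms(6) by (simp add: filterlim_at_top)
  then have "\<forall>\<^sub>F n in sequentially. 1 - exp (- 1 * (ln (real n))\<^sup>2)
      - real n * exp (- 1 * (real n * p n)) \<le> measure_pmf.prob (erdos_renyi n (p n)) (S n)"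
    using eventually_ge_at_top[of 3] by eventually_elim (rule bound)
  moreover have "D1 > 0" "D2 > 0" using assms(2) by (auto simp: D1_def D2_def)
  ultimately show ?thesis unfolding S_def by (intro exI[of _ D1] exI[of _ D2] exI[of _ 1] conjI) auto
qed

end
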